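(* Let $1<\beta<2$ and $r<0$. Let $u$ be the solution of the Caputo fractional initial value problem $$D^\beta_t u-ru=0,\quad t>0,\qquad u(0)=1,\quad u'(0)=1,$$ namely $u(t)=E_\beta(rt^\beta)+t\,E_{\beta,2}(rt^\beta)$. Then $$\beta=1-\lim_{t\to\infty}\frac{t\,u'(t)}{u(t)}.$$
   Context: For $n-1<\beta<n$, $n\in\mathbb{N}$, the Caputo fractional derivative (lower terminal $0$) is $(D^\beta_t f)(t)=\frac{1}{\Gamma(n-\beta)}\int_0^t (t-\tau)^{n-\beta-1}f^{(n)}(\tau)\,d\tau$, $t>0$. The Mittag-Leffler functions are $E_\alpha(z)=\sum_{k\ge0}\frac{z^k}{\Gamma(k\alpha+1)}$ and $E_{\alpha,\beta}(z)=\sum_{k\ge0}\frac{z^k}{\Gamma(k\alpha+\beta)}$. *)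

theory Defs
  imports "HOL-Analysis.Analysis"
begin

definition mittag_leffler2 :: "real \<Rightarrow> real \<Rightarrow> real \<Rightarrow> real" where
  "mittag_leffler2 a b z = (\<Sum>k. z ^ k / Gamma (real k * a + b))"

definition mittag_leffler :: "real \<Rightarrow> real \<Rightarrow> real" where
  "mittag_leffler a z = (\<Sum>k. z ^ k / Gamma (real k * a + 1))"

text \<open>The solution u(t) = E_beta(r t^beta) + t E_{beta,2}(r t^beta) of the Caputo IVP
  D^beta u - r u = 0, u(0)=1, u'(0)=1.\<close>
definition caputo_sol :: "real \<Rightarrow> real \<Rightarrow> real \<Rightarrow> real" where
  "caputo_sol \<beta> r t = mittag_leffler \<beta> (r * t powr \<beta>) + t * mittag_leffler2 \<beta> 2 (r * t powr \<beta>)"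

end

theory Submission
  imports Defs "HOL-Complex_Analysis.Complex_Analysis" "HOL-Real_Asymp.Real_Asymp"
begin

text \<open>
  Write \<open>E\<^sub>b\<close> for the two-parameter Mittag-Leffler function with parameters \<open>\<beta>, b\<close> and put
  \<open>z = r t\<^sup>\<beta>\<close>. Termwise differentiation gives \<open>t u'(t) = E\<^sub>0(z) + t E\<^sub>1(z)\<close>, while
  \<open>u(t) = E\<^sub>1(z) + t E\<^sub>2(z)\<close>. So it suffices to show \<open>x E\<^sub>b(-x) \<rightarrow> 1/\<Gamma>(b - \<beta>)\<close> as
  \<open>x \<rightarrow> \<infinity>\<close>: the limit of the quotient is then \<open>\<Gamma>(2 - \<beta>)/\<Gamma>(1 - \<beta>) = 1 - \<beta>\<close>.

  The asymptotics come from Hankel's contour. Inserting Hankel's integral for \<open>1/\<Gamma>(b + \<beta> k)\<close> in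
  the series and summing the geometric series gives \<open>E\<^sub>b(-x)\<close> as the integral of
  \<open>e\<^sup>s s\<^bsup>\<beta>-b\<^esup>/(s\<^sup>\<beta> + x)\<close> over a contour that runs around the origin at a radius with
  \<open>|s|\<^sup>\<beta> > x\<close>. Since \<open>\<beta> < 2\<close>, the poles have argument \<open>\<plusminus>\<pi>/\<beta>\<close> beyond \<open>\<plusminus>\<pi>/2\<close>, so the contour can be
  contracted to two rays from the origin at an angle \<open>\<pi>/2 < \<theta> < \<pi>/\<beta>\<close>, on which \<open>e\<^sup>s\<close> decays.
  Dominated convergence then replaces \<open>x/(s\<^sup>\<beta> + x)\<close> by 1 and leaves Hankel's integral
  for \<open>1/\<Gamma>(b - \<beta>)\<close>.

  Everything is written in the logarithmic coordinate \<open>w = ln s\<close>: circular arcs become vertical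
  segments, rays become horizontal lines, and the integrands are holomorphic on a strip, where they
  have a primitive. The limit of the arc integral as the radius tends to infinity plays the role of the
  integral over Hankel's contour.
\<close>

section \<open>Contour integrals in the logarithmic coordinate\<close>

text \<open>On the segment \<open>w = Complex c \<phi>\<close> one has dw = i
  d\<open>\<phi>\<close>, so this is the integral of f(w) dw / (2 pi i) over the image of the arc of
  radius \<open>exp c\<close>.\<close>

definition arc_integral :: "real \<Rightarrow> (complex \<Rightarrow> complex) \<Rightarrow> real \<Rightarrow> complex" where
  "arc_integral \<theta> f c = integral {-\<theta>..\<theta>} (\<lambda>\<phi>. f (Complex c \<phi>)) / of_real (2 * pi)"

lemma Complex_has_vector_derivative_right:
  "((\<lambda>\<phi>. Complex c \<phi>) has_vector_derivative \<i>) (at x within S)"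
  unfolding Complex_eq has_vector_derivative_def
  by (auto intro!: derivative_eq_intros simp: scaleR_conv_of_real)

lemma Complex_has_vector_derivative_left:
  "((\<lambda>\<xi>. Complex \<xi> c) has_vector_derivative 1) (at x within S)"
  unfolding Complex_eq has_vector_derivative_def
  by (auto intro!: derivative_eq_intros simp: scaleR_conv_of_real)

lemma continuous_on_Complex_right [continuous_intros]: "continuous_on S (Complex c)"
  unfolding Complex_eq by (intro continuous_intros)

lemma continuous_on_Complex_left [continuous_intros]: "continuous_on S (\<lambda>\<xi>. Complex \<xi> c)"
  unfolding Complex_eq by (intro continuous_intros)

lemma integral_horizontal_primitive:
  assumes "c \<le> N" and "\<And>\<xi>. \<xi> \<in> {c..N} \<Longrightarrow> (P has_field_derivative f (Complex \<xi> \<phi>)) (at (Complex \<xi> \<phi>))"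
  shows "((\<lambda>\<xi>. f (Complex \<xi> \<phi>)) has_integral P (Complex N \<phi>) - P (Complex c \<phi>)) {c..N}"
proof (rule fundamental_theorem_of_calculus [OF assms(1)])
  fix \<xi> assume "\<xi> \<in> {c..N}"
  from field_vector_diff_chain_at [OF Complex_has_vector_derivative_left assms(2) [OF this]]
  show "((\<lambda>\<xi>. P (Complex \<xi> \<phi>)) has_vector_derivative f (Complex \<xi> \<phi>)) (at \<xi> within {c..N})"
    by (simp add: o_def has_vector_derivative_at_within)
qed

lemma integral_vertical_primitive:
  assumes "a \<le> b" and "\<And>\<phi>. \<phi> \<in> {a..b} \<Longrightarrow> (P has_field_derivative f (Complex c \<phi>)) (at (Complex c \<phi>))"
  shows "((\<lambda>\<phi>. f (Complex c \<phi>)) has_integral (P (Complex c b) - P (Complex c a)) / \<i>) {a..b}"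
proof -
  have "((\<lambda>\<phi>. \<i> * f (Complex c \<phi>)) has_integral (P (Complex c b) - P (Complex c a))) {a..b}"
  proof (rule fundamental_theorem_of_calculus [OF assms(1)])
    fix \<phi> assume "\<phi> \<in> {a..b}"
    from field_vector_diff_chain_at [OF Complex_has_vector_derivative_right assms(2) [OF this]]
    show "((\<lambda>\<phi>. P (Complex c \<phi>)) has_vector_derivative \<i> * f (Complex c \<phi>)) (at \<phi> within {a..b})"
      by (simp add: o_def has_vector_derivative_at_within)
  qed
  from has_integral_mult_right [OF this, of "-\<i>"] show ?thesis
    by (simp add: mult.assoc [symmetric])
qed

text \<open>Cauchy's theorem on a rectangle: a primitive \<open>P\<close> reduces every side to
  corner values. By the reflection symmetry the lower side is the conjugate of the upper one, so
  together they contribute the imaginary part of a single ray integral.\<close>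

lemma arc_integral_diff:
  assumes "open S" "convex S" "f holomorphic_on S" and strip: "{z. \<bar>Im z\<bar> \<le> \<theta>} \<subseteq> S"
    and sym: "\<And>z. z \<in> S \<Longrightarrow> f (cnj z) = cnj (f z)" and "0 \<le> \<theta>" "c \<le> N"
  shows "arc_integral \<theta> f N - arc_integral \<theta> f c =
    of_real (Im (integral {c..N} (\<lambda>\<xi>. f (Complex \<xi> \<theta>))) / pi)"
proof -
  obtain P where P: "\<And>z. z \<in> S \<Longrightarrow> (P has_field_derivative f z) (at z)"
    using holomorphic_convex_primitive' [OF assms(2,1,3)] \<open>open S\<close>
    by (metis at_within_open)
  have S: "Complex \<xi> \<phi> \<in> S" if "\<bar>\<phi>\<bar> \<le> \<theta>" for \<xi> \<phi>
    using strip that by auto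
  have arc: "arc_integral \<theta> f a = (P (Complex a \<theta>) - P (Complex a (-\<theta>))) / (2 * pi * \<i>)" for a
    unfolding arc_integral_def
    by (subst integral_unique [OF integral_vertical_primitive [where P = P]])
       (use \<open>0 \<le> \<theta>\<close> in \<open>auto intro!: P S simp: field_simps\<close>)
  define J where "J = integral {c..N} (\<lambda>\<xi>. f (Complex \<xi> \<theta>))"
  have up: "J = P (Complex N \<theta>) - P (Complex c \<theta>)"
    unfolding J_def
    by (intro integral_unique integral_horizontal_primitive \<open>c \<le> N\<close> P S) (use \<open>0 \<le> \<theta>\<close> in auto)
  have "integral {c..N} (\<lambda>\<xi>. f (Complex \<xi> (-\<theta>))) = integral {c..N} (\<lambda>\<xi>. cnj (f (Complex \<xi> \<theta>)))"
    using sym [OF S [of \<theta>]] \<open>0 \<le> \<theta>\<close> by (intro integral_cong) (simp add: complex_cnj)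
  also have "\<dots> = cnj J" by (simp add: J_def integral_cnj)
  finally have down: "cnj J = P (Complex N (-\<theta>)) - P (Complex c (-\<theta>))"
    by (subst (asm) integral_unique [OF integral_horizontal_primitive [where P = P]])
       (use \<open>0 \<le> \<theta>\<close> \<open>c \<le> N\<close> in \<open>auto intro!: P S\<close>)
  have "arc_integral \<theta> f N - arc_integral \<theta> f c = (J - cnj J) / (2 * pi * \<i>)"
    unfolding arc down unfolding up by (simp add: diff_divide_distrib [symmetric])
  also have "\<dots> = of_real (Im J / pi)"
    by (simp add: complex_diff_cnj complex_eq_iff)
  finally show ?thesis unfolding J_def .
qed

lemma norm_arc_integral_le:
  assumes "continuous_on {-\<theta>..\<theta>} (\<lambda>\<phi>. f (Complex c \<phi>))" "0 \<le> \<theta>" "\<theta> \<le> pi"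
    and "\<And>\<phi>. \<bar>\<phi>\<bar> \<le> \<theta> \<Longrightarrow> norm (f (Complex c \<phi>)) \<le> M"
  shows "norm (arc_integral \<theta> f c) \<le> M"
proof -
  have "0 \<le> M" using assms(4) [of 0] norm_ge_zero \<open>0 \<le> \<theta>\<close> by (meson abs_zero order_trans order.refl abs_le_zero_iff)
  have "norm (integral {-\<theta>..\<theta>} (\<lambda>\<phi>. f (Complex c \<phi>))) \<le> M * (\<theta> - (-\<theta>))"
    using assms by (intro integral_bound) auto
  also have "\<dots> \<le> M * (2 * pi)" using assms(3) \<open>0 \<le> M\<close> by (intro mult_left_mono) auto
  finally show ?thesis
    by (simp add: arc_integral_def norm_divide divide_simps)
qed

lemma dominated_integral_UNIV:
  fixes f :: "real \<Rightarrow> complex"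
  assumes "continuous_on UNIV f" "h integrable_on UNIV" "\<And>x. norm (f x) \<le> h x"
  shows "f integrable_on UNIV"
    and "(\<lambda>n. integral {-real n..real n} f) \<longlonglongrightarrow> integral UNIV f"
proof -
  let ?F = "\<lambda>n x. if x \<in> {-real n..real n} then f x else 0"
  have F: "?F k integrable_on UNIV" for k
    unfolding integrable_restrict_UNIV
    by (intro integrable_continuous_real continuous_on_subset [OF assms(1)]) auto
  have bound: "norm (?F k x) \<le> h x" for k x
    using assms(3) [of x] norm_ge_zero [of "f x"] by (auto simp del: norm_ge_zero)
  have lim: "(\<lambda>k. ?F k x) \<longlonglongrightarrow> f x" for x
  proof (rule tendsto_eventually)
    have "eventually (\<lambda>k. real k \<ge> \<bar>x\<bar>) sequentially" by real_asymp
    thus "\<forall>\<^sub>F k in sequentially. ?F k x = f x" by eventually_elim auto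
  qed
  show "f integrable_on UNIV"
    by (rule dominated_convergence(1) [OF F assms(2) bound lim])
  show "(\<lambda>n. integral {-real n..real n} f) \<longlonglongrightarrow> integral UNIV f"
    using dominated_convergence(2) [OF F assms(2) bound lim] unfolding integral_restrict_UNIV .
qed

text \<open>Contraction of the contour: the inner radius \<open>exp (- real n)\<close> tends to 0,
  where the arc contributes nothing in the limit, while the outer radius tends to infinity. What is
  left is the integral over the whole ray.\<close>

lemma arc_integral_tendsto_ray:
  assumes "open S" "convex S" "f holomorphic_on S" and strip: "{z. \<bar>Im z\<bar> \<le> \<theta>} \<subseteq> S"
    and sym: "\<And>z. z \<in> S \<Longrightarrow> f (cnj z) = cnj (f z)" and "0 \<le> \<theta>"
    and bound: "h integrable_on UNIV" "\<And>\<xi>. norm (f (Complex \<xi> \<theta>)) \<le> h \<xi>"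
    and left: "(\<lambda>n. arc_integral \<theta> f (- real n)) \<longlonglongrightarrow> 0"
  shows "(\<lambda>n. arc_integral \<theta> f (real n)) \<longlonglongrightarrow>
    of_real (Im (integral UNIV (\<lambda>\<xi>. f (Complex \<xi> \<theta>))) / pi)"
proof -
  have cont: "continuous_on UNIV (\<lambda>\<xi>. f (Complex \<xi> \<theta>))"
    by (rule continuous_on_compose2 [OF holomorphic_on_imp_continuous_on [OF assms(3)]])
       (use strip \<open>0 \<le> \<theta>\<close> in \<open>auto intro!: continuous_intros\<close>)
  have "(\<lambda>n. arc_integral \<theta> f (- real n) +
          of_real (Im (integral {-real n..real n} (\<lambda>\<xi>. f (Complex \<xi> \<theta>))) / pi)) \<longlonglongrightarrow>
        0 + of_real (Im (integral UNIV (\<lambda>\<xi>. f (Complex \<xi> \<theta>))) / pi)"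
    by (intro tendsto_intros left dominated_integral_UNIV(2) [OF cont bound]) auto
  moreover have "arc_integral \<theta> f (- real n) +
        of_real (Im (integral {-real n..real n} (\<lambda>\<xi>. f (Complex \<xi> \<theta>))) / pi) =
      arc_integral \<theta> f (real n)" for n
    using arc_integral_diff [OF assms(1-6), of "-real n" "real n"] by (simp add: algebra_simps)
  ultimately show ?thesis by simp
qed

section \<open>Hankel's integral for the reciprocal Gamma function\<close>

text \<open>With s = exp w this is e^s s^(1-z). The exponent is 1-z rather than -z because ds = s
  dw, so the arc integral is that of Hankel's integrand e^s s^(-z) ds / (2 pi i).\<close>

definition hankel_kernel :: "real \<Rightarrow> complex \<Rightarrow> complex" where
  "hankel_kernel z w = exp (exp w + of_real (1 - z) * w)"

lemma norm_hankel_kernel: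
  "norm (hankel_kernel z (Complex \<xi> \<phi>)) = exp (exp \<xi> * cos \<phi> + (1 - z) * \<xi>)"
  by (simp add: hankel_kernel_def norm_exp_eq_Re Re_exp)

lemma hankel_kernel_cnj: "hankel_kernel z (cnj w) = cnj (hankel_kernel z w)"
  by (simp add: hankel_kernel_def exp_cnj)

lemma holomorphic_on_hankel_kernel [holomorphic_intros]: "hankel_kernel z holomorphic_on S"
  unfolding hankel_kernel_def [abs_def] by (intro holomorphic_intros)

lemma continuous_on_hankel_kernel [continuous_intros]:
  "continuous_on S f \<Longrightarrow> continuous_on S (\<lambda>x. hankel_kernel z (f x))"
  unfolding hankel_kernel_def by (intro continuous_intros)

text \<open>The integration by parts behind the functional equation of
  \<open>rGamma\<close>.\<close>

lemma hankel_kernel_has_field_derivative: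
  "(hankel_kernel (z + 1) has_field_derivative
     hankel_kernel z w - of_real z * hankel_kernel (z + 1) w) (at w)"
proof -
  have "exp (exp w + of_real (1 - z) * w) = exp (exp w + of_real (1 - (z + 1)) * w) * exp w"
    by (simp add: exp_add [symmetric] algebra_simps)
  thus ?thesis unfolding hankel_kernel_def [abs_def]
    by (auto intro!: derivative_eq_intros simp: algebra_simps)
qed

text \<open>Euler's integral after the substitution t = exp \<open>\<xi>\<close>. The parameter
  \<open>a\<close> later becomes \<open>- cos \<theta>\<close>, the decay rate on a ray.\<close>

lemma integral_exp_Gamma:
  fixes s a :: real
  assumes "s > 0" "a > 0"
  shows "(\<lambda>\<xi>. exp (s * \<xi> - a * exp \<xi>)) integrable_on UNIV"
    and "a = 1 \<Longrightarrow> integral UNIV (\<lambda>\<xi>. exp (s * \<xi> - a * exp \<xi>)) = Gamma s"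
proof -
  define f where "f = (\<lambda>t::real. t powr (s - 1) / exp (a * t))"
  have "(\<lambda>t. Re (complex_of_real t powr (of_real s - 1) / of_real (exp (a * t)))) absolutely_integrable_on {0<..}"
    using absolutely_integrable_linear [OF absolutely_integrable_Gamma_integral [of "of_real s" a] bounded_linear_Re] assms
    by (simp add: o_def)
  also have "?this \<longleftrightarrow> f absolutely_integrable_on {0<..}"
    unfolding f_def
    by (intro set_integrable_cong refl)
       (auto simp flip: of_real_divide simp: powr_of_real [of _ "s - 1", simplified])
  finally have f: "f absolutely_integrable_on {0<..}" .
  have eq: "\<bar>exp \<xi>\<bar> * f (exp \<xi>) = exp (s * \<xi> - a * exp \<xi>)" for \<xi>
    by (simp add: f_def powr_def exp_diff algebra_simps exp_add)
  have range: "range exp = {0::real<..}"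
    by (auto simp: image_iff) (metis exp_ln)
  have *: "(\<lambda>\<xi>. exp (s * \<xi> - a * exp \<xi>)) absolutely_integrable_on UNIV \<and>
      integral UNIV (\<lambda>\<xi>. exp (s * \<xi> - a * exp \<xi>)) = b \<longleftrightarrow>
      f absolutely_integrable_on {0<..} \<and> integral {0<..} f = b" for b
    using has_absolute_integral_change_of_variables_1' [of UNIV exp exp f b]
    unfolding eq range by (auto simp: inj_on_def intro: DERIV_exp)
  show "(\<lambda>\<xi>. exp (s * \<xi> - a * exp \<xi>)) integrable_on UNIV"
    using * [of "integral {0<..} f"] f by (intro set_lebesgue_integral_eq_integral(1)) simp
  assume "a = 1"
  have "(f has_integral Gamma s) {0..}"
    using Gamma_integral_real [OF \<open>s > 0\<close>] by (simp add: f_def \<open>a = 1\<close>)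
  hence "integral {0..} f = Gamma s"
    by (rule integral_unique)
  moreover have "integral {0<..} f = integral {0..} f"
    by (rule integral_spike_set) (auto intro: negligible_subset [of "{0}"])
  ultimately show "integral UNIV (\<lambda>\<xi>. exp (s * \<xi> - a * exp \<xi>)) = Gamma s"
    using * [of "Gamma s"] f by simp
qed

lemma exp_exp_tendsto_0:
  assumes "a < 0"
  shows "(\<lambda>n. exp (exp (real n) * a + s * real n)) \<longlonglongrightarrow> 0"
  using assms by real_asymp

lemma exp_exp_minus_tendsto_0:
  assumes "s > 0"
  shows "(\<lambda>n. exp (exp (- real n) + s * - real n)) \<longlonglongrightarrow> 0"
  using assms by real_asymp

lemma arc_integral_hankel_kernel_left:
  assumes "z < 1" "0 \<le> \<theta>" "\<theta> \<le> pi"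
  shows "(\<lambda>n. arc_integral \<theta> (hankel_kernel z) (- real n)) \<longlonglongrightarrow> 0"
proof (rule Lim_null_comparison [OF always_eventually])
  show "\<forall>n. norm (arc_integral \<theta> (hankel_kernel z) (- real n)) \<le> exp (exp (- real n) + (1 - z) * - real n)"
    using assms
    by (auto intro!: norm_arc_integral_le continuous_intros simp: norm_hankel_kernel)
  show "(\<lambda>n. exp (exp (- real n) + (1 - z) * - real n)) \<longlonglongrightarrow> 0"
    by (rule exp_exp_minus_tendsto_0) (use assms(1) in simp)
qed

lemma rGamma_reflection_real: "rGamma z * rGamma (1 - z :: real) = sin (pi * z) / pi"
proof -
  have "complex_of_real (rGamma z * rGamma (1 - z)) = of_real (sin (pi * z) / pi)"
    using rGamma_reflection_complex [of "of_real z"] rGamma_complex_of_real [of z]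
      rGamma_complex_of_real [of "1 - z"] sin_of_real [of "pi * z", where 'a = complex]
    by simp
  thus ?thesis using of_real_eq_iff by blast
qed

text \<open>Euler's reflection formula, in the shape produced by the ray integral at angle
  pi.\<close>

lemma rGamma_reflection_less_1:
  assumes "z < 1"
  shows "sin (pi * (1 - z)) * Gamma (1 - z) / pi = rGamma (z::real)"
proof -
  have "Gamma (1 - z) > 0" using assms by (intro Gamma_real_pos) auto
  hence "rGamma (1 - z) > 0" "Gamma (1 - z) * rGamma (1 - z) = 1"
    by (auto simp: rGamma_inverse_Gamma)
  moreover have "sin (pi * (1 - z)) = sin (pi * z)"
    by (simp add: algebra_simps sin_diff)
  ultimately show ?thesis using rGamma_reflection_real [of z]
    by (simp add: field_simps) (metis mult.left_commute mult.right_neutral mult.commute)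
qed

text \<open>For z < 1 the contour collapses onto the negative real axis, where the kernel is a
  constant phase times the integrand of Euler's integral for Gamma(1-z); the reflection formula does
  the rest.\<close>

lemma arc_integral_pi_hankel_kernel_less_1:
  assumes "z < 1"
  shows "(\<lambda>n. arc_integral pi (hankel_kernel z) (real n)) \<longlonglongrightarrow> of_real (rGamma z)"
proof -
  have K: "hankel_kernel z (Complex \<xi> pi) =
      cis (pi * (1 - z)) * of_real (exp ((1 - z) * \<xi> - 1 * exp \<xi>))" for \<xi>
  proof -
    have "exp (Complex \<xi> pi) + of_real (1 - z) * Complex \<xi> pi =
        \<i> * of_real (pi * (1 - z)) + of_real ((1 - z) * \<xi> - 1 * exp \<xi>)"
      by (simp add: complex_eq_iff Re_exp Im_exp)
    thus ?thesis
      unfolding hankel_kernel_def by (simp only: exp_add cis_conv_exp exp_of_real)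
  qed
  have int: "integral UNIV (\<lambda>\<xi>. hankel_kernel z (Complex \<xi> pi)) = cis (pi * (1 - z)) * of_real (Gamma (1 - z))"
    unfolding K using integral_exp_Gamma [of "1 - z" 1] assms
    by (intro integral_unique has_integral_mult_right has_integral_of_real) (auto simp: has_integral_iff)
  have "(\<lambda>n. arc_integral pi (hankel_kernel z) (real n)) \<longlonglongrightarrow>
      of_real (Im (integral UNIV (\<lambda>\<xi>. hankel_kernel z (Complex \<xi> pi))) / pi)"
  proof (rule arc_integral_tendsto_ray [of UNIV])
    show "(\<lambda>\<xi>. exp ((1 - z) * \<xi> - 1 * exp \<xi>)) integrable_on UNIV"
      using assms by (intro integral_exp_Gamma(1)) auto
  qed (use assms in \<open>auto intro!: holomorphic_intros arc_integral_hankel_kernel_left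
         simp: hankel_kernel_cnj norm_hankel_kernel\<close>)
  thus ?thesis using rGamma_reflection_less_1 [OF assms] by (simp add: int)
qed

text \<open>At z = 1 the small arc no longer vanishes. Instead the kernel is real on the ray, so the
  arc integrals at radii \<open>exp (real n)\<close> and \<open>exp (- real n)\<close> agree, and
  for small radius the integrand exp(exp w) tends to 1.\<close>

lemma arc_integral_pi_hankel_kernel_1:
  "(\<lambda>n. arc_integral pi (hankel_kernel 1) (real n)) \<longlonglongrightarrow> of_real (rGamma 1)"
proof -
  have "Im (hankel_kernel 1 (Complex \<xi> pi)) = 0" for \<xi>
    by (simp add: hankel_kernel_def Im_exp)
  hence "Im (integral {-real n..real n} (\<lambda>\<xi>. hankel_kernel 1 (Complex \<xi> pi))) = 0" for n
    by (subst integral_linear [OF _ bounded_linear_Im, symmetric])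
       (auto intro!: integrable_continuous_real continuous_intros simp: o_def)
  hence "arc_integral pi (hankel_kernel 1) (real n) = arc_integral pi (hankel_kernel 1) (- real n)" for n
    using arc_integral_diff [of UNIV "hankel_kernel 1" pi "-real n" "real n"]
    by (auto simp: hankel_kernel_cnj intro!: holomorphic_intros)
  moreover have "(\<lambda>n. arc_integral pi (hankel_kernel 1) (- real n)) \<longlonglongrightarrow> 1"
  proof (subst LIM_zero_iff [symmetric], rule Lim_null_comparison)
    have eq: "arc_integral pi (hankel_kernel 1) c - 1 = arc_integral pi (\<lambda>w. hankel_kernel 1 w - 1) c" for c
      unfolding arc_integral_def
      by (subst integral_diff)
         (auto intro!: integrable_continuous_real continuous_intros simp: field_simps scaleR_conv_of_real)
    have "eventually (\<lambda>n. exp (- real n) \<le> 1 / 2) sequentially" by real_asymp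
    thus "\<forall>\<^sub>F n in sequentially. norm (arc_integral pi (hankel_kernel 1) (- real n) - 1) \<le> 3 / 2 * exp (- real n)"
    proof eventually_elim
      case (elim n)
      have "norm (exp (exp (Complex (- real n) \<phi>)) - 1) \<le> 3 / 2 * exp (- real n)" for \<phi>
        using norm_exp_bounds(2) [of "exp (Complex (- real n) \<phi>)"] elim by (simp add: norm_exp_eq_Re)
      thus ?case
        unfolding eq
        by (intro norm_arc_integral_le) (auto intro!: continuous_intros simp: hankel_kernel_def)
    qed
    show "(\<lambda>n. 3 / 2 * exp (- real n)) \<longlonglongrightarrow> 0" by real_asymp
  qed
  ultimately show ?thesis by simp
qed

text \<open>The difference consists of boundary terms at the two arc ends, which lie in the left
  half-plane and so decay doubly exponentially.\<close>

lemma arc_integral_hankel_kernel_recursion: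
  assumes "cos \<theta> < 0" "0 \<le> \<theta>"
  shows "(\<lambda>n. arc_integral \<theta> (hankel_kernel z) (real n)
             - of_real z * arc_integral \<theta> (hankel_kernel (z + 1)) (real n)) \<longlonglongrightarrow> 0"
proof (rule Lim_null_comparison [OF always_eventually])
  let ?K = "hankel_kernel z" and ?K' = "hankel_kernel (z + 1)"
  have eq: "arc_integral \<theta> ?K c - of_real z * arc_integral \<theta> ?K' c =
      (?K' (Complex c \<theta>) - ?K' (Complex c (-\<theta>))) / \<i> / of_real (2 * pi)" for c
  proof -
    have "((\<lambda>\<phi>. ?K (Complex c \<phi>) - z * ?K' (Complex c \<phi>)) has_integral
        (?K' (Complex c \<theta>) - ?K' (Complex c (-\<theta>))) / \<i>) {-\<theta>..\<theta>}"
      using assms by (intro integral_vertical_primitive hankel_kernel_has_field_derivative) auto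
    moreover have "((\<lambda>\<phi>. ?K (Complex c \<phi>) - z * ?K' (Complex c \<phi>)) has_integral
        (integral {-\<theta>..\<theta>} (\<lambda>\<phi>. ?K (Complex c \<phi>)) - z * integral {-\<theta>..\<theta>} (\<lambda>\<phi>. ?K' (Complex c \<phi>)))) {-\<theta>..\<theta>}"
      by (intro has_integral_diff has_integral_mult_right integrable_integral
            integrable_continuous_real continuous_intros)
    ultimately have "integral {-\<theta>..\<theta>} (\<lambda>\<phi>. ?K (Complex c \<phi>)) - z * integral {-\<theta>..\<theta>} (\<lambda>\<phi>. ?K' (Complex c \<phi>)) =
        (?K' (Complex c \<theta>) - ?K' (Complex c (-\<theta>))) / \<i>"
      using has_integral_unique by blast
    thus ?thesis
      unfolding arc_integral_def times_divide_eq_right diff_divide_distrib [symmetric] by (rule arg_cong)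
  qed
  show "\<forall>n. norm (arc_integral \<theta> ?K (real n) - of_real z * arc_integral \<theta> ?K' (real n)) \<le>
      exp (exp (real n) * cos \<theta> + (- z) * real n) / pi"
  proof
    fix n
    show "norm (arc_integral \<theta> ?K (real n) - of_real z * arc_integral \<theta> ?K' (real n)) \<le>
      exp (exp (real n) * cos \<theta> + (- z) * real n) / pi"
      unfolding eq norm_divide
      using norm_triangle_ineq4 [of "?K' (Complex n \<theta>)" "?K' (Complex n (-\<theta>))"]
      by (simp add: norm_hankel_kernel divide_simps mult.commute)
  qed
  show "(\<lambda>n. exp (exp (real n) * cos \<theta> + (- z) * real n) / pi) \<longlonglongrightarrow> 0"
    by (rule tendsto_divide_zero [OF exp_exp_tendsto_0 [OF assms(1)]])
qed

text \<open>The recursion carries the result upwards from z-1 to z. It divides by z-1, which is why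
  z = 1 needed its own proof.\<close>

lemma arc_integral_pi_hankel_kernel:
  "(\<lambda>n. arc_integral pi (hankel_kernel z) (real n)) \<longlonglongrightarrow> of_real (rGamma z)"
proof -
  have "(\<lambda>n. arc_integral pi (hankel_kernel z) (real n)) \<longlonglongrightarrow> of_real (rGamma z)"
    if "z \<le> real m" for m
    using that
  proof (induction m arbitrary: z)
    case 0
    thus ?case by (intro arc_integral_pi_hankel_kernel_less_1) auto
  next
    case (Suc m)
    show ?case
    proof (cases "z \<le> 1")
      case True
      thus ?thesis using arc_integral_pi_hankel_kernel_1 arc_integral_pi_hankel_kernel_less_1
        by (cases "z = 1") auto
    next
      case False
      let ?A = "\<lambda>z n. arc_integral pi (hankel_kernel z) (real n)"
      have "(\<lambda>n. (?A (z - 1) n - (?A (z - 1) n - of_real (z - 1) * ?A (z - 1 + 1) n)) / of_real (z - 1))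
          \<longlonglongrightarrow> (of_real (rGamma (z - 1)) - 0) / of_real (z - 1)"
        using False Suc.prems
        by (intro tendsto_intros Suc.IH arc_integral_hankel_kernel_recursion) auto
      moreover have "of_real (rGamma (z - 1)) - 0 = (of_real (z - 1) :: complex) * of_real (rGamma z)"
        using rGamma_plus1 [of "z - 1"] by (simp flip: of_real_mult del: of_real_diff)
      ultimately show ?thesis using False by simp
    qed
  qed
  from this [of "nat \<lceil>z\<rceil>"] show ?thesis by linarith
qed

text \<open>Narrowing the arc from pi to \<open>\<theta>\<close> discards two pieces on which cos
  \<open>\<phi>\<close> is at most cos \<open>\<theta>\<close> < 0, so they vanish in the
  limit.\<close>

lemma arc_integral_hankel_kernel:
  assumes "pi / 2 < \<theta>" "\<theta> \<le> pi"
  shows "(\<lambda>n. arc_integral \<theta> (hankel_kernel z) (real n)) \<longlonglongrightarrow> of_real (rGamma z)"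
proof -
  let ?K = "hankel_kernel z"
  define M where "M n = exp (exp (real n) * cos \<theta> + (1 - z) * real n)" for n
  have "cos \<theta> < 0" using assms cos_monotone_0_pi [of "pi / 2" \<theta>] by auto
  have "(\<lambda>n. arc_integral pi ?K (real n) - arc_integral \<theta> ?K (real n)) \<longlonglongrightarrow> 0"
  proof (rule Lim_null_comparison [OF always_eventually])
    show "M \<longlonglongrightarrow> 0" unfolding M_def by (rule exp_exp_tendsto_0) fact
    show "\<forall>n. norm (arc_integral pi ?K (real n) - arc_integral \<theta> ?K (real n)) \<le> M n"
    proof
      fix n
      define f where "f = (\<lambda>\<phi>. ?K (Complex (real n) \<phi>))"
      have int: "f integrable_on {a..b}" for a b
        unfolding f_def by (intro integrable_continuous_real continuous_intros)
      have bound: "norm (integral {a..b} f) \<le> M n * (b - a)"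
        if "a \<le> b" "\<And>\<phi>. \<phi> \<in> {a..b} \<Longrightarrow> \<theta> \<le> \<bar>\<phi>\<bar> \<and> \<bar>\<phi>\<bar> \<le> pi" for a b
      proof (rule integral_bound [OF that(1)])
        show "continuous_on {a..b} f" unfolding f_def by (intro continuous_intros)
        fix \<phi> assume "\<phi> \<in> {a..b}"
        hence "cos \<bar>\<phi>\<bar> \<le> cos \<theta>" using that(2) assms pi_gt_zero
          by (intro cos_monotone_0_pi_le) (auto simp del: cos_abs_real)
        thus "norm (f \<phi>) \<le> M n" by (simp add: f_def norm_hankel_kernel M_def)
      qed
      have "integral {-pi..pi} f = integral {-pi..-\<theta>} f + integral {-\<theta>..\<theta>} f + integral {\<theta>..pi} f"
        using assms pi_gt_zero by (simp add: Henstock_Kurzweil_Integration.integral_combine int add.assoc del: pi_gt_zero)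
      hence "arc_integral pi ?K (real n) - arc_integral \<theta> ?K (real n) =
          (integral {-pi..-\<theta>} f + integral {\<theta>..pi} f) / of_real (2 * pi)"
        by (simp add: arc_integral_def f_def [symmetric] diff_divide_distrib [symmetric])
      also have "norm \<dots> \<le> (M n * (- \<theta> - - pi) + M n * (pi - \<theta>)) / (2 * pi)"
        unfolding norm_divide
        using norm_triangle_mono [OF bound bound, of "-pi" "-\<theta>" \<theta> pi] assms pi_gt_zero
        by (auto simp: field_simps simp del: pi_gt_zero)
      also have "\<dots> = M n * ((pi - \<theta>) / pi)" by (simp add: field_simps)
      also have "\<dots> \<le> M n * 1"
        using assms by (intro mult_left_mono) (auto simp: M_def field_simps)
      finally show "norm (arc_integral pi ?K (real n) - arc_integral \<theta> ?K (real n)) \<le> M n" by simp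
    qed
  qed
  from tendsto_diff [OF arc_integral_pi_hankel_kernel [of z] this] show ?thesis by simp
qed

section \<open>The Mittag-Leffler kernel and its bounds\<close>

text \<open>For |exp w|^\<open>\<alpha>\<close> > x this is the sum of the geometric series with
  terms \<open>(-x) ^ k * hankel_kernel (b + \<alpha> * real k) w\<close>.\<close>

definition mittag_leffler_kernel :: "real \<Rightarrow> real \<Rightarrow> real \<Rightarrow> complex \<Rightarrow> complex" where
  "mittag_leffler_kernel \<alpha> b x w =
     hankel_kernel (b - \<alpha>) w / (exp (of_real \<alpha> * w) + of_real x)"

text \<open>Law of cosines, then completing the square after replacing the angle by the extreme one
  \<open>\<alpha> * \<theta>\<close>. The bound is linear in x, which makes x times the kernel
  bounded uniformly in x.\<close>

lemma norm_exp_plus_ge: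
  assumes "\<alpha> > 0" "x > 0" "\<alpha> * \<theta> < pi" "\<bar>Im w\<bar> \<le> \<theta>"
  shows "norm (exp (of_real \<alpha> * w) + of_real x) \<ge> x * sin (\<alpha> * \<theta>)"
proof -
  define s where "s = exp (\<alpha> * Re w)"
  define \<psi> where "\<psi> = \<alpha> * Im w"
  have "\<bar>\<psi>\<bar> \<le> \<alpha> * \<theta>" using assms by (simp add: \<psi>_def abs_mult)
  hence "cos (\<alpha> * \<theta>) \<le> cos \<bar>\<psi>\<bar>"
    using assms by (intro cos_monotone_0_pi_le) (auto simp del: cos_abs_real)
  hence cos: "s * x * cos (\<alpha> * \<theta>) \<le> s * x * cos \<psi>"
    using assms by (intro mult_left_mono) (auto simp: s_def)
  have "(x * sin (\<alpha> * \<theta>))\<^sup>2 \<le> (s + x * cos (\<alpha> * \<theta>))\<^sup>2 + (x * sin (\<alpha> * \<theta>))\<^sup>2" by simp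
  also have "\<dots> = s\<^sup>2 + 2 * (s * x * cos (\<alpha> * \<theta>)) + x\<^sup>2 * ((cos (\<alpha> * \<theta>))\<^sup>2 + (sin (\<alpha> * \<theta>))\<^sup>2)"
    by algebra
  also have "\<dots> \<le> s\<^sup>2 * ((cos \<psi>)\<^sup>2 + (sin \<psi>)\<^sup>2) + 2 * (s * x * cos \<psi>) + x\<^sup>2"
    using cos by simp
  also have "\<dots> = (s * cos \<psi> + x)\<^sup>2 + (s * sin \<psi>)\<^sup>2"
    by algebra
  also have "\<dots> = (norm (exp (of_real \<alpha> * w) + of_real x))\<^sup>2"
    by (simp add: cmod_power2 Re_exp Im_exp s_def \<psi>_def)
  finally show ?thesis by (rule power2_le_imp_le) simp
qed

lemma norm_mittag_leffler_kernel_le: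
  assumes "\<alpha> > 0" "x > 0" "0 < \<theta>" "\<alpha> * \<theta> < pi" "\<bar>\<phi>\<bar> \<le> \<theta>"
  shows "norm (mittag_leffler_kernel \<alpha> b x (Complex \<xi> \<phi>)) \<le>
    exp (exp \<xi> * cos \<phi> + (1 - (b - \<alpha>)) * \<xi>) / (x * sin (\<alpha> * \<theta>))"
proof -
  have pos: "0 < x * sin (\<alpha> * \<theta>)"
    using assms by (intro mult_pos_pos sin_gt_zero) auto
  have le: "x * sin (\<alpha> * \<theta>) \<le> norm (exp (of_real \<alpha> * Complex \<xi> \<phi>) + of_real x)"
    using assms by (intro norm_exp_plus_ge) auto
  show ?thesis
    unfolding mittag_leffler_kernel_def norm_divide norm_hankel_kernel
    using le mult_pos_pos [OF less_le_trans [OF pos le] pos] by (intro divide_left_mono) auto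
qed

lemma exp_plus_nonzero:
  assumes "\<alpha> > 0" "x > 0" "\<bar>Im w\<bar> < pi / \<alpha>"
  shows "exp (of_real \<alpha> * w) + of_real x \<noteq> 0"
\<comment> \<open>The lower bound with \<open>\<theta>\<close> = \<open>\<bar>Im w\<bar>\<close>
  degenerates to 0 on the real axis, where positivity of exp is used instead.\<close>
proof (cases "Im w = 0")
  case True
  hence "Re (exp (of_real \<alpha> * w) + of_real x) > 0"
    using assms by (simp add: Re_exp add_pos_pos)
  thus ?thesis by (metis less_irrefl zero_complex.simps(1))
next
  case False
  have "0 < x * sin (\<alpha> * \<bar>Im w\<bar>)"
    using assms False by (intro mult_pos_pos sin_gt_zero) (auto simp: field_simps)
  also have "\<dots> \<le> norm (exp (of_real \<alpha> * w) + of_real x)"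
    using assms by (intro norm_exp_plus_ge) (auto simp: field_simps)
  finally show ?thesis by auto
qed

text \<open>The identity 1/(1+y) = 1 - y/(1+y) with y = x exp(-\<open>\<alpha>\<close> w); it needs
  no smallness of y.\<close>

lemma mittag_leffler_kernel_step:
  assumes "\<alpha> > 0" "x > 0" "\<bar>Im w\<bar> < pi / \<alpha>"
  shows "mittag_leffler_kernel \<alpha> b x w =
    hankel_kernel b w - of_real x * mittag_leffler_kernel \<alpha> (b + \<alpha>) x w"
proof -
  have "hankel_kernel (b - \<alpha>) w = hankel_kernel b w * exp (of_real \<alpha> * w)"
    by (simp add: hankel_kernel_def exp_add [symmetric] algebra_simps)
  thus ?thesis using exp_plus_nonzero [OF assms]
    by (simp add: mittag_leffler_kernel_def field_simps)
qed

lemma mittag_leffler_kernel_shift: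
  "mittag_leffler_kernel \<alpha> (b + s) x w = exp (- of_real s * w) * mittag_leffler_kernel \<alpha> b x w"
  by (simp add: mittag_leffler_kernel_def hankel_kernel_def exp_add [symmetric] algebra_simps)

lemma mittag_leffler_kernel_cnj:
  "mittag_leffler_kernel \<alpha> b x (cnj w) = cnj (mittag_leffler_kernel \<alpha> b x w)"
  by (simp add: mittag_leffler_kernel_def hankel_kernel_cnj exp_cnj)

lemma holomorphic_on_mittag_leffler_kernel:
  assumes "\<alpha> > 0" "x > 0"
  shows "mittag_leffler_kernel \<alpha> b x holomorphic_on {w. \<bar>Im w\<bar> < pi / \<alpha>}"
  unfolding mittag_leffler_kernel_def [abs_def]
  using assms exp_plus_nonzero by (intro holomorphic_intros) auto

lemma open_convex_strip:
  "open {w. \<bar>Im w\<bar> < r}" "convex {w. \<bar>Im w\<bar> < r}"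
proof -
  have eq: "{w. \<bar>Im w\<bar> < r} = {w. Im w < r} \<inter> {w. Im w > - r}" by auto
  show "open {w. \<bar>Im w\<bar> < r}"
    unfolding eq by (intro open_Int open_halfspace_Im_lt open_halfspace_Im_gt)
  show "convex {w. \<bar>Im w\<bar> < r}"
    unfolding eq by (intro convex_Int convex_halfspace_Im_lt convex_halfspace_Im_gt)
qed

lemma continuous_on_mittag_leffler_kernel:
  assumes "\<alpha> > 0" "x > 0" "continuous_on T g" "\<And>t. t \<in> T \<Longrightarrow> \<bar>Im (g t)\<bar> < pi / \<alpha>"
  shows "continuous_on T (\<lambda>t. mittag_leffler_kernel \<alpha> b x (g t))"
  by (rule continuous_on_compose2 [OF holomorphic_on_imp_continuous_on
        [OF holomorphic_on_mittag_leffler_kernel] assms(3)])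
     (use assms in auto)

text \<open>The rays at angle \<open>\<theta>\<close> lie in the left half-plane, but stay to the right of the poles of
  the Mittag-Leffler kernel, which have argument \<open>\<plusminus>\<pi>/\<alpha>\<close>.\<close>
locale mittag_leffler_ray =
  fixes \<alpha> \<theta> :: real
  assumes alpha: "\<alpha> > 0" and theta: "pi / 2 < \<theta>" "\<theta> \<le> pi" "\<alpha> * \<theta> < pi"
begin

lemma theta_pos: "0 < \<theta>"
  using theta pi_half_gt_zero by linarith

lemma cos_theta: "cos \<theta> < 0"
  using theta cos_monotone_0_pi [of "pi / 2" \<theta>] by auto

lemma sin_alpha_theta: "0 < sin (\<alpha> * \<theta>)"
  using alpha theta theta_pos by (intro sin_gt_zero) auto

lemma theta_less: "\<theta> < pi / \<alpha>"
  using theta alpha by (simp add: field_simps)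

text \<open>A majorant on the ray for x times the kernel, free of x. Integrability at minus infinity
  comes from b < 1 + \<open>\<alpha>\<close>, at plus infinity from cos \<open>\<theta>\<close> <
  0.\<close>

definition ray_bound :: "real \<Rightarrow> real \<Rightarrow> real" where
  "ray_bound b \<xi> = exp (exp \<xi> * cos \<theta> + (1 - (b - \<alpha>)) * \<xi>) / sin (\<alpha> * \<theta>)"

lemma ray_bound_integrable:
  assumes "b < 1 + \<alpha>"
  shows "ray_bound b integrable_on UNIV"
proof -
  have "(\<lambda>\<xi>. exp ((1 - (b - \<alpha>)) * \<xi> - (- cos \<theta>) * exp \<xi>) / sin (\<alpha> * \<theta>)) integrable_on UNIV"
    using assms cos_theta by (intro integrable_on_divide integral_exp_Gamma(1)) auto
  thus ?thesis by (simp add: ray_bound_def [abs_def] algebra_simps)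
qed

lemma norm_kernel_ray_le:
  "x > 0 \<Longrightarrow> norm (mittag_leffler_kernel \<alpha> b x (Complex \<xi> \<theta>)) \<le> ray_bound b \<xi> / x"
  using norm_mittag_leffler_kernel_le [OF alpha _ theta_pos theta(3), of x \<theta> b \<xi>] theta_pos
  by (simp add: ray_bound_def mult.commute)

lemma kernel_arc_integrable:
  assumes "x > 0"
  shows "(\<lambda>\<phi>. mittag_leffler_kernel \<alpha> b x (Complex c \<phi>)) integrable_on {-\<theta>..\<theta>}"
  using assms alpha theta_less
  by (intro integrable_continuous_real continuous_on_mittag_leffler_kernel continuous_intros) auto

section \<open>The Mittag-Leffler series as a ray integral\<close>

lemma arc_integral_kernel_step:
  assumes "x > 0"
  shows "arc_integral \<theta> (mittag_leffler_kernel \<alpha> b x) c = arc_integral \<theta> (hankel_kernel b) c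
    - of_real x * arc_integral \<theta> (mittag_leffler_kernel \<alpha> (b + \<alpha>) x) c"
proof -
  have "integral {-\<theta>..\<theta>} (\<lambda>\<phi>. mittag_leffler_kernel \<alpha> b x (Complex c \<phi>)) =
    integral {-\<theta>..\<theta>} (\<lambda>\<phi>. hankel_kernel b (Complex c \<phi>) -
      of_real x * mittag_leffler_kernel \<alpha> (b + \<alpha>) x (Complex c \<phi>))"
    using theta_less alpha assms by (intro integral_cong mittag_leffler_kernel_step) auto
  also have "\<dots> = integral {-\<theta>..\<theta>} (\<lambda>\<phi>. hankel_kernel b (Complex c \<phi>)) -
      of_real x * integral {-\<theta>..\<theta>} (\<lambda>\<phi>. mittag_leffler_kernel \<alpha> (b + \<alpha>) x (Complex c \<phi>))"
    by (intro integral_unique has_integral_diff has_integral_mult_right integrable_integral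
          kernel_arc_integrable assms integrable_continuous_real continuous_intros)
  finally show ?thesis by (simp add: arc_integral_def diff_divide_distrib)
qed

text \<open>A finite geometric expansion with exact remainder, so that no infinite sum has to be
  exchanged with an integral.\<close>

lemma arc_integral_kernel_expansion:
  assumes "x > 0"
  shows "arc_integral \<theta> (mittag_leffler_kernel \<alpha> b x) c =
    (\<Sum>k<m. of_real ((-x) ^ k) * arc_integral \<theta> (hankel_kernel (b + \<alpha> * real k)) c) +
    of_real ((-x) ^ m) * arc_integral \<theta> (mittag_leffler_kernel \<alpha> (b + \<alpha> * real m) x) c"
proof (induction m)
  case (Suc m)
  show ?case
    unfolding Suc.IH
    by (subst arc_integral_kernel_step [OF assms]) (simp add: algebra_simps)
qed auto

lemma norm_arc_integral_kernel_le:
  assumes "x > 0"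
  shows "norm (arc_integral \<theta> (mittag_leffler_kernel \<alpha> b x) c) \<le>
    exp (exp c + (1 - (b - \<alpha>)) * c) / (x * sin (\<alpha> * \<theta>))"
proof (rule norm_arc_integral_le)
  show "continuous_on {-\<theta>..\<theta>} (\<lambda>\<phi>. mittag_leffler_kernel \<alpha> b x (Complex c \<phi>))"
    using assms alpha theta_less by (intro continuous_on_mittag_leffler_kernel continuous_intros) auto
  fix \<phi> assume "\<bar>\<phi>\<bar> \<le> \<theta>"
  hence "norm (mittag_leffler_kernel \<alpha> b x (Complex c \<phi>)) \<le>
      exp (exp c * cos \<phi> + (1 - (b - \<alpha>)) * c) / (x * sin (\<alpha> * \<theta>))"
    by (intro norm_mittag_leffler_kernel_le alpha assms theta theta_pos)
  also have "\<dots> \<le> exp (exp c + (1 - (b - \<alpha>)) * c) / (x * sin (\<alpha> * \<theta>))"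
    using assms sin_alpha_theta by (intro divide_right_mono) auto
  finally show "norm (mittag_leffler_kernel \<alpha> b x (Complex c \<phi>)) \<le>
      exp (exp c + (1 - (b - \<alpha>)) * c) / (x * sin (\<alpha> * \<theta>))" .
qed (use theta theta_pos in auto)

lemma arc_integral_kernel_tendsto:
  assumes "x > 0" "b < 1 + \<alpha>"
  shows "(\<lambda>n. arc_integral \<theta> (mittag_leffler_kernel \<alpha> b x) (real n)) \<longlonglongrightarrow>
    of_real (Im (integral UNIV (\<lambda>\<xi>. mittag_leffler_kernel \<alpha> b x (Complex \<xi> \<theta>))) / pi)"
proof (rule arc_integral_tendsto_ray [OF open_convex_strip holomorphic_on_mittag_leffler_kernel])
  show "(\<lambda>\<xi>. ray_bound b \<xi> / x) integrable_on UNIV"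
    by (intro integrable_on_divide ray_bound_integrable assms)
  show "(\<lambda>n. arc_integral \<theta> (mittag_leffler_kernel \<alpha> b x) (- real n)) \<longlonglongrightarrow> 0"
  proof (rule Lim_null_comparison [OF always_eventually])
    show "\<forall>n. norm (arc_integral \<theta> (mittag_leffler_kernel \<alpha> b x) (- real n)) \<le>
        exp (exp (- real n) + (1 - (b - \<alpha>)) * - real n) / (x * sin (\<alpha> * \<theta>))"
      using norm_arc_integral_kernel_le [OF assms(1)] by blast
    show "(\<lambda>n. exp (exp (- real n) + (1 - (b - \<alpha>)) * - real n) / (x * sin (\<alpha> * \<theta>))) \<longlonglongrightarrow> 0"
      using assms(2) by (intro tendsto_divide_zero exp_exp_minus_tendsto_0) auto
  qed
qed (use assms alpha theta_pos theta_less norm_kernel_ray_le mittag_leffler_kernel_cnj in auto)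

text \<open>A remainder bound independent of \<open>N\<close>: the arc at \<open>N\<close> is moved
  back to a fixed arc at \<open>c\<close>, at the cost of ray pieces between them. There the shift
  by \<open>s\<close> contributes a factor of modulus at most \<open>exp (- s * c)\<close>.\<close>

lemma norm_arc_integral_kernel_shift_le:
  assumes "x > 0" "b < 1 + \<alpha>" "s \<ge> 0" "c \<le> N"
  shows "norm (arc_integral \<theta> (mittag_leffler_kernel \<alpha> (b + s) x) N) \<le>
    exp (- s * c) * (exp (exp c + (1 - (b - \<alpha>)) * c) / (x * sin (\<alpha> * \<theta>)) +
      integral UNIV (ray_bound b) / x / pi)"
proof -
  let ?f = "mittag_leffler_kernel \<alpha> (b + s) x"
  let ?g = "\<lambda>\<xi>. exp (- s * c) * (ray_bound b \<xi> / x)"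
  have g: "?g integrable_on T" if "T = UNIV \<or> T = {c..N}" for T
  proof -
    have "?g integrable_on UNIV"
      by (intro integrable_on_mult_right integrable_on_divide ray_bound_integrable assms)
    thus ?thesis using that integrable_on_subinterval [of ?g UNIV c N] by auto
  qed
  have ge0: "0 \<le> ray_bound b \<xi>" for \<xi>
    using sin_alpha_theta by (simp add: ray_bound_def)
  have "norm (integral {c..N} (\<lambda>\<xi>. ?f (Complex \<xi> \<theta>))) \<le> integral {c..N} ?g"
  proof (rule integral_norm_bound_integral)
    show "(\<lambda>\<xi>. ?f (Complex \<xi> \<theta>)) integrable_on {c..N}"
      using assms alpha theta_less theta_pos
      by (intro integrable_continuous_real continuous_on_mittag_leffler_kernel continuous_intros) auto
    show "norm (?f (Complex \<xi> \<theta>)) \<le> ?g \<xi>" if "\<xi> \<in> {c..N}" for \<xi>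
      unfolding mittag_leffler_kernel_shift norm_mult
      using that norm_kernel_ray_le [OF assms(1), of b \<xi>] \<open>s \<ge> 0\<close>
      by (intro mult_mono) (auto simp: norm_exp_eq_Re mult_left_mono)
  qed (use g in auto)
  also have "\<dots> \<le> integral UNIV ?g"
    using g ge0 \<open>x > 0\<close> by (intro integral_subset_le) auto
  also have "\<dots> = exp (- s * c) * (integral UNIV (ray_bound b) / x)"
    using ray_bound_integrable [OF assms(2)]
    by (intro integral_unique has_integral_mult_right has_integral_divide integrable_integral)
  finally have ray: "norm (integral {c..N} (\<lambda>\<xi>. ?f (Complex \<xi> \<theta>))) \<le>
      exp (- s * c) * (integral UNIV (ray_bound b) / x)" .
  have "arc_integral \<theta> ?f N - arc_integral \<theta> ?f c =
      of_real (Im (integral {c..N} (\<lambda>\<xi>. ?f (Complex \<xi> \<theta>))) / pi)"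
    by (rule arc_integral_diff [OF open_convex_strip holomorphic_on_mittag_leffler_kernel])
       (use assms alpha theta_pos theta_less mittag_leffler_kernel_cnj in auto)
  hence "norm (arc_integral \<theta> ?f N - arc_integral \<theta> ?f c) =
      \<bar>Im (integral {c..N} (\<lambda>\<xi>. ?f (Complex \<xi> \<theta>)))\<bar> / pi"
    by (simp only: norm_of_real abs_divide abs_of_pos [OF pi_gt_zero])
  also have "\<dots> \<le> exp (- s * c) * (integral UNIV (ray_bound b) / x) / pi"
    by (rule divide_right_mono [OF order_trans [OF abs_Im_le_cmod ray]]) simp
  finally have diff: "norm (arc_integral \<theta> ?f N - arc_integral \<theta> ?f c) \<le>
      exp (- s * c) * (integral UNIV (ray_bound b) / x) / pi" .
  have "exp (exp c + (1 - (b + s - \<alpha>)) * c) = exp (- s * c) * exp (exp c + (1 - (b - \<alpha>)) * c)"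
    by (simp add: exp_add [symmetric] algebra_simps)
  hence "norm (arc_integral \<theta> ?f c) \<le>
      exp (- s * c) * (exp (exp c + (1 - (b - \<alpha>)) * c) / (x * sin (\<alpha> * \<theta>)))"
    using norm_arc_integral_kernel_le [OF assms(1), of "b + s" c] by simp
  with diff show ?thesis
    using norm_triangle_ineq [of "arc_integral \<theta> ?f N - arc_integral \<theta> ?f c" "arc_integral \<theta> ?f c"]
    by (simp add: distrib_left)
qed

theorem mittag_leffler_series_sums_ray_integral:
  assumes "x > 0" "b < 1 + \<alpha>"
  shows "(\<lambda>k. (-x) ^ k * rGamma (b + \<alpha> * real k)) sums
    (Im (integral UNIV (\<lambda>\<xi>. mittag_leffler_kernel \<alpha> b x (Complex \<xi> \<theta>))) / pi)"
    (is "?a sums ?L")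
proof -
  let ?A = "\<lambda>b n. arc_integral \<theta> (mittag_leffler_kernel \<alpha> b x) (real n)"
  \<comment> \<open>Radius \<open>exp c\<close> is taken beyond the poles, where the geometric
    series converges with ratio \<open>q\<close>.\<close>
  have "eventually (\<lambda>c. x * exp (- \<alpha> * c) < 1) at_top"
    using alpha by real_asymp
  then obtain c where c: "x * exp (- \<alpha> * c) < 1"
    by (auto simp: eventually_at_top_linorder)
  define q where "q = x * exp (- \<alpha> * c)"
  define C where "C = exp (exp c + (1 - (b - \<alpha>)) * c) / (x * sin (\<alpha> * \<theta>)) +
      integral UNIV (ray_bound b) / x / pi"
  \<comment> \<open>For fixed \<open>m\<close> the outer radius goes to infinity first, turning the
    finite expansion into partial sums of the series; only afterwards does \<open>m\<close>
    grow.\<close>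
  have bound: "\<bar>?L - (\<Sum>k<m. ?a k)\<bar> \<le> q ^ m * C" for m
  proof -
    have "(\<lambda>n. ?A b n - (\<Sum>k<m. of_real ((-x) ^ k) * arc_integral \<theta> (hankel_kernel (b + \<alpha> * real k)) (real n)))
        \<longlonglongrightarrow> of_real ?L - (\<Sum>k<m. of_real ((-x) ^ k) * of_real (rGamma (b + \<alpha> * real k)))"
      using theta by (intro tendsto_intros arc_integral_kernel_tendsto arc_integral_hankel_kernel assms) auto
    hence "(\<lambda>n. of_real ((-x) ^ m) * ?A (b + \<alpha> * real m) n) \<longlonglongrightarrow> of_real (?L - (\<Sum>k<m. ?a k))"
      by (subst (asm) arc_integral_kernel_expansion [OF assms(1), of _ _ m]) simp
    moreover have "\<forall>\<^sub>F n in sequentially. norm (of_real ((-x) ^ m) * ?A (b + \<alpha> * real m) n) \<le> q ^ m * C"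
    proof -
      have "eventually (\<lambda>n. real n \<ge> c) sequentially" by real_asymp
      thus ?thesis
      proof eventually_elim
        case (elim n)
        have "norm (?A (b + \<alpha> * real m) n) \<le> exp (- (\<alpha> * real m) * c) * C"
          unfolding C_def using alpha
          by (intro norm_arc_integral_kernel_shift_le assms elim) auto
        hence "x ^ m * norm (?A (b + \<alpha> * real m) n) \<le> x ^ m * (exp (- (\<alpha> * real m) * c) * C)"
          using assms(1) by (intro mult_left_mono) auto
        also have "exp (- (\<alpha> * real m) * c) = exp (- \<alpha> * c) ^ m"
          by (simp add: exp_of_nat_mult [symmetric] algebra_simps)
        finally show ?case using assms(1)
          by (simp add: q_def norm_mult norm_power power_mult_distrib mult.assoc)
      qed
    qed
    ultimately have "norm (of_real (?L - (\<Sum>k<m. ?a k)) :: complex) \<le> q ^ m * C"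
      by (intro tendsto_upperbound [OF tendsto_norm]) auto
    thus ?thesis by (simp only: norm_of_real)
  qed
  have "q \<ge> 0" "q < 1" using c assms(1) by (auto simp: q_def)
  hence q: "(\<lambda>m. q ^ m * C) \<longlonglongrightarrow> 0"
    by (intro tendsto_mult_left_zero LIMSEQ_power_zero) auto
  have "(\<lambda>m. ?L - (\<Sum>k<m. ?a k)) \<longlonglongrightarrow> 0"
  proof (rule Lim_null_comparison [OF always_eventually q], rule allI)
    show "norm (?L - (\<Sum>k<m. ?a k)) \<le> q ^ m * C" for m
      unfolding real_norm_def by (rule bound)
  qed
  from tendsto_diff [OF tendsto_const [of ?L] this] show ?thesis
    by (simp add: sums_def)
qed

section \<open>Asymptotics of the ray integral\<close>

text \<open>The same arc integrals have two limits, one by contraction to the rays and one by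
  Hankel's formula; uniqueness identifies them.\<close>

lemma hankel_ray_integral:
  assumes "b < 1 + \<alpha>"
  shows "Im (integral UNIV (\<lambda>\<xi>. hankel_kernel (b - \<alpha>) (Complex \<xi> \<theta>))) / pi = rGamma (b - \<alpha>)"
proof -
  have "(\<lambda>n. arc_integral \<theta> (hankel_kernel (b - \<alpha>)) (real n)) \<longlonglongrightarrow>
      of_real (Im (integral UNIV (\<lambda>\<xi>. hankel_kernel (b - \<alpha>) (Complex \<xi> \<theta>))) / pi)"
  proof (rule arc_integral_tendsto_ray [of UNIV])
    show "(\<lambda>\<xi>. ray_bound b \<xi> * sin (\<alpha> * \<theta>)) integrable_on UNIV"
      by (intro integrable_on_mult_left ray_bound_integrable assms)
  qed (use assms theta theta_pos sin_alpha_theta in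
        \<open>auto intro!: holomorphic_intros arc_integral_hankel_kernel_left
           simp: hankel_kernel_cnj norm_hankel_kernel ray_bound_def\<close>)
  from LIMSEQ_unique [OF this arc_integral_hankel_kernel [OF theta(1,2)]] show ?thesis
    using of_real_eq_iff by blast
qed

theorem mittag_leffler_ray_integral_asymptotics:
  assumes "b < 1 + \<alpha>"
  shows "((\<lambda>x. x * (Im (integral UNIV (\<lambda>\<xi>. mittag_leffler_kernel \<alpha> b x (Complex \<xi> \<theta>))) / pi))
    \<longlongrightarrow> rGamma (b - \<alpha>)) at_top"
proof (rule tendsto_at_topI_sequentially)
  fix X :: "nat \<Rightarrow> real" assume X: "filterlim X at_top sequentially"
  \<comment> \<open>Dominated convergence needs the bound for every index, hence positive values
    throughout; \<open>Y\<close> and \<open>X\<close> agree eventually.\<close>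
  define Y where "Y n = max 1 (X n)" for n
  have Y: "filterlim Y at_top sequentially"
    by (rule filterlim_at_top_mono [OF X always_eventually]) (simp add: Y_def)
  have pos: "Y n > 0" for n by (simp add: Y_def)
  let ?f = "\<lambda>n \<xi>. of_real (Y n) * mittag_leffler_kernel \<alpha> b (Y n) (Complex \<xi> \<theta>)"
  have bound: "norm (?f n \<xi>) \<le> ray_bound b \<xi>" for n \<xi>
    using mult_left_mono [OF norm_kernel_ray_le [OF pos [of n], of b \<xi>], of "Y n"] pos [of n]
    by (simp add: norm_mult)
  have "?f n integrable_on UNIV" for n
    using pos alpha theta_pos theta_less
    by (intro dominated_integral_UNIV(1) [OF _ ray_bound_integrable [OF assms] bound]
          continuous_on_mittag_leffler_kernel continuous_intros) auto
  moreover have "(\<lambda>n. ?f n \<xi>) \<longlonglongrightarrow> hankel_kernel (b - \<alpha>) (Complex \<xi> \<theta>)" for \<xi>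
  proof -
    define e where "e = exp (of_real \<alpha> * Complex \<xi> \<theta>)"
    have "(\<lambda>n. hankel_kernel (b - \<alpha>) (Complex \<xi> \<theta>) / (e * of_real (inverse (Y n)) + 1)) \<longlonglongrightarrow>
        hankel_kernel (b - \<alpha>) (Complex \<xi> \<theta>) / (e * of_real 0 + 1)"
      by (intro tendsto_intros tendsto_inverse_0_at_top Y) auto
    moreover have "?f n \<xi> = hankel_kernel (b - \<alpha>) (Complex \<xi> \<theta>) / (e * of_real (inverse (Y n)) + 1)" for n
      using pos [of n] by (simp add: mittag_leffler_kernel_def e_def field_simps)
    ultimately show ?thesis by simp
  qed
  ultimately have "(\<lambda>n. integral UNIV (?f n)) \<longlonglongrightarrow> integral UNIV (\<lambda>\<xi>. hankel_kernel (b - \<alpha>) (Complex \<xi> \<theta>))"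
    by (intro dominated_convergence(2) [OF _ ray_bound_integrable [OF assms]] bound) auto
  hence "(\<lambda>n. Im (integral UNIV (?f n)) / pi) \<longlonglongrightarrow> rGamma (b - \<alpha>)"
    unfolding hankel_ray_integral [OF assms, symmetric] by (intro tendsto_intros) auto
  moreover have "\<forall>\<^sub>F n in sequentially. Im (integral UNIV (?f n)) / pi =
      X n * (Im (integral UNIV (\<lambda>\<xi>. mittag_leffler_kernel \<alpha> b (X n) (Complex \<xi> \<theta>))) / pi)"
    using filterlim_at_top_dense [THEN iffD1, OF X, rule_format, of 1]
    by eventually_elim (simp add: Y_def)
  ultimately show "(\<lambda>n. X n * (Im (integral UNIV (\<lambda>\<xi>. mittag_leffler_kernel \<alpha> b (X n) (Complex \<xi> \<theta>))) / pi))
      \<longlonglongrightarrow> rGamma (b - \<alpha>)"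
    by (rule Lim_transform_eventually)
qed

end

section \<open>Asymptotics and differentiation of the Mittag-Leffler functions\<close>

text \<open>At a pole \<open>Gamma\<close> has the default value 0, and division by 0 gives 0 =
  \<open>rGamma\<close>. This matters for b = 0, k = 0.\<close>

lemma mittag_leffler2_altdef:
  "mittag_leffler2 \<alpha> b z = (\<Sum>k. rGamma (b + \<alpha> * real k) * z ^ k)"
  by (simp add: mittag_leffler2_def Gamma_def field_simps)

lemma mittag_leffler_conv_mittag_leffler2: "mittag_leffler \<alpha> = mittag_leffler2 \<alpha> 1"
  by (simp add: fun_eq_iff mittag_leffler_def mittag_leffler2_def)

lemma mittag_leffler_ray_exists:
  assumes "1 < \<alpha>" "\<alpha> < 2"
  obtains \<theta> where "mittag_leffler_ray \<alpha> \<theta>"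
proof
  have "pi / 2 < pi / \<alpha>" "pi / \<alpha> < pi" using assms by (auto simp: field_simps)
  moreover define \<theta> where "\<theta> = (pi / 2 + pi / \<alpha>) / 2"
  ultimately have "pi / 2 < \<theta>" "\<theta> < pi / \<alpha>" "\<theta> \<le> pi" by auto
  thus "mittag_leffler_ray \<alpha> \<theta>"
    using assms by unfold_locales (auto simp: field_simps)
qed

text \<open>Convergence at the larger point -(|z| + 1) is already known from the ray integral, so no
  growth estimate for Gamma is required.\<close>

lemma mittag_leffler2_summable:
  assumes "1 < \<alpha>" "\<alpha> < 2" "b < 1 + \<alpha>"
  shows "summable (\<lambda>k. rGamma (b + \<alpha> * real k) * z ^ k)"
proof -
  obtain \<theta> where "mittag_leffler_ray \<alpha> \<theta>" using mittag_leffler_ray_exists assms by blast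
  then interpret mittag_leffler_ray \<alpha> \<theta> .
  have "summable (\<lambda>k. rGamma (b + \<alpha> * real k) * (- (\<bar>z\<bar> + 1)) ^ k)"
    using mittag_leffler_series_sums_ray_integral [of "\<bar>z\<bar> + 1" b] assms
    by (simp add: sums_iff mult.commute)
  thus ?thesis by (rule powser_inside) auto
qed

theorem mittag_leffler2_asymptotics:
  assumes "1 < \<alpha>" "\<alpha> < 2" "b < 1 + \<alpha>"
  shows "((\<lambda>x. x * mittag_leffler2 \<alpha> b (-x)) \<longlongrightarrow> rGamma (b - \<alpha>)) at_top"
proof -
  obtain \<theta> where "mittag_leffler_ray \<alpha> \<theta>" using mittag_leffler_ray_exists assms by blast
  then interpret mittag_leffler_ray \<alpha> \<theta> .
  show ?thesis
  proof (rule Lim_transform_eventually [OF mittag_leffler_ray_integral_asymptotics [OF assms(3)]])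
    show "\<forall>\<^sub>F x in at_top. x * (Im (integral UNIV (\<lambda>\<xi>. mittag_leffler_kernel \<alpha> b x (Complex \<xi> \<theta>))) / pi) =
        x * mittag_leffler2 \<alpha> b (-x)"
      using eventually_gt_at_top [of 0]
    proof eventually_elim
      case (elim x)
      from mittag_leffler_series_sums_ray_integral [OF this assms(3)] show ?case
        by (simp add: mittag_leffler2_altdef sums_iff mult.commute)
    qed
  qed
qed

text \<open>Coefficientwise, \<open>\<alpha> * k + (b - 1)\<close> is the factor by which the
  functional equation of \<open>rGamma\<close> lowers b by one.\<close>

lemma mittag_leffler2_has_field_derivative:
  assumes "1 < \<alpha>" "\<alpha> < 2" "b < 1 + \<alpha>" "z \<noteq> 0"
  shows "(mittag_leffler2 \<alpha> b has_field_derivative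
    (mittag_leffler2 \<alpha> (b - 1) z - (b - 1) * mittag_leffler2 \<alpha> b z) / (\<alpha> * z)) (at z)"
proof -
  define c where "c k = rGamma (b + \<alpha> * real k)" for k
  define D where "D = (\<Sum>k. diffs c k * z ^ k)"
  have summable: "summable (\<lambda>k. c k * y ^ k)" for y
    unfolding c_def by (rule mittag_leffler2_summable [OF assms(1-3)])
  have "((\<lambda>y. \<Sum>k. c k * y ^ k) has_field_derivative D) (at z)"
    unfolding D_def by (rule termdiffs_strong_converges_everywhere [OF summable])
  hence deriv: "(mittag_leffler2 \<alpha> b has_field_derivative D) (at z)"
    by (simp add: mittag_leffler2_altdef [abs_def] c_def)
  have "(\<lambda>k. of_nat k * c k * z ^ (k - Suc 0)) sums D"
    unfolding D_def using summable by (intro diffs_equiv termdiff_converges_all)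
  hence "(\<lambda>k. \<alpha> * z * (of_nat k * c k * z ^ (k - Suc 0)) + (b - 1) * (c k * z ^ k)) sums
      (\<alpha> * z * D + (b - 1) * mittag_leffler2 \<alpha> b z)"
    unfolding mittag_leffler2_altdef c_def [symmetric]
    by (intro sums_add sums_mult summable_sums summable)
  also have "(\<lambda>k. \<alpha> * z * (of_nat k * c k * z ^ (k - Suc 0)) + (b - 1) * (c k * z ^ k)) =
      (\<lambda>k. rGamma (b - 1 + \<alpha> * real k) * z ^ k)"
  proof
    fix k
    have power: "\<alpha> * z * (of_nat k * c k * z ^ (k - Suc 0)) = \<alpha> * real k * c k * z ^ k"
      by (cases k) auto
    have rG: "(b - 1 + \<alpha> * real k) * c k = rGamma (b - 1 + \<alpha> * real k)"
      using rGamma_plus1 [of "b - 1 + \<alpha> * real k"] by (simp add: c_def algebra_simps)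
    show "\<alpha> * z * (of_nat k * c k * z ^ (k - Suc 0)) + (b - 1) * (c k * z ^ k) =
        rGamma (b - 1 + \<alpha> * real k) * z ^ k"
      unfolding power rG [symmetric] by (simp add: algebra_simps)
  qed
  finally have "mittag_leffler2 \<alpha> (b - 1) z = \<alpha> * z * D + (b - 1) * mittag_leffler2 \<alpha> b z"
    by (simp add: mittag_leffler2_altdef [of _ "b - 1"] sums_iff)
  hence "D = (mittag_leffler2 \<alpha> (b - 1) z - (b - 1) * mittag_leffler2 \<alpha> b z) / (\<alpha> * z)"
    using assms by (simp add: field_simps)
  with deriv show ?thesis by simp
qed

section \<open>The solution of the Caputo problem\<close>

lemma deriv_caputo_sol:
  assumes "1 < \<beta>" "\<beta> < 2" "r \<noteq> 0" "t > 0"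
  shows "deriv (caputo_sol \<beta> r) t =
    mittag_leffler2 \<beta> 0 (r * t powr \<beta>) / t + mittag_leffler2 \<beta> 1 (r * t powr \<beta>)"
proof (rule DERIV_imp_deriv)
  define z where "z = r * t powr \<beta>"
  have "z \<noteq> 0" using assms by (simp add: z_def)
  have dz: "((\<lambda>t. r * t powr \<beta>) has_field_derivative \<beta> * z / t) (at t)"
    using assms by (auto intro!: derivative_eq_intros simp: z_def powr_diff)
  have E: "((\<lambda>t. mittag_leffler2 \<beta> b (r * t powr \<beta>)) has_field_derivative
      (mittag_leffler2 \<beta> (b - 1) z - (b - 1) * mittag_leffler2 \<beta> b z) / t) (at t)"
    if "b < 1 + \<beta>" for b
    using DERIV_chain2 [OF mittag_leffler2_has_field_derivative [OF assms(1,2) that \<open>z \<noteq> 0\<close>,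
        unfolded z_def] dz] assms \<open>z \<noteq> 0\<close>
    by (simp flip: z_def)
  show "(caputo_sol \<beta> r has_field_derivative
      mittag_leffler2 \<beta> 0 z / t + mittag_leffler2 \<beta> 1 z) (at t)"
    unfolding caputo_sol_def [abs_def] mittag_leffler_conv_mittag_leffler2
    using assms
    by (auto intro!: derivative_eq_intros E simp: z_def [symmetric])
qed

theorem theorem3:
  fixes \<beta> r :: real
  assumes "1 < \<beta>" and "\<beta> < 2" and "r < 0"
  shows "((\<lambda>t. t * deriv (caputo_sol \<beta> r) t / caputo_sol \<beta> r t) \<longlongrightarrow> 1 - \<beta>) at_top"
proof -
  define x where "x t = - r * t powr \<beta>" for t
  have x: "filterlim x at_top at_top"
    unfolding x_def using assms by real_asymp
  define F where "F b t = x t * mittag_leffler2 \<beta> b (- x t)" for b t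
  have F: "(F b \<longlongrightarrow> rGamma (b - \<beta>)) at_top" if "b < 1 + \<beta>" for b
    unfolding F_def using filterlim_compose [OF mittag_leffler2_asymptotics [OF assms(1,2) that] x] .
  have inv: "((\<lambda>t::real. inverse t) \<longlongrightarrow> 0) at_top"
    by (rule tendsto_inverse_0_at_top) (rule filterlim_ident)
  have nz: "rGamma (2 - \<beta>) \<noteq> 0"
    using assms Gamma_real_pos [of "2 - \<beta>"] by (auto simp: Gamma_def)
  \<comment> \<open>Numerator and denominator of the quotient are both scaled by x(t)/t, so that
    each has a finite limit and the terms with \<open>inverse t\<close> drop out.\<close>
  have "((\<lambda>t. (F 0 t * inverse t + F 1 t) / (F 1 t * inverse t + F 2 t)) \<longlongrightarrow>
      (rGamma (0 - \<beta>) * 0 + rGamma (1 - \<beta>)) / (rGamma (1 - \<beta>) * 0 + rGamma (2 - \<beta>))) at_top"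
    using assms nz by (intro tendsto_intros F inv) auto
  \<comment> \<open>The functional equation gives rGamma(1-\<open>\<beta>\<close>) =
    (1-\<open>\<beta>\<close>) rGamma(2-\<open>\<beta>\<close>).\<close>
  also have "(rGamma (0 - \<beta>) * 0 + rGamma (1 - \<beta>)) / (rGamma (1 - \<beta>) * 0 + rGamma (2 - \<beta>)) = 1 - \<beta>"
    using nz rGamma_plus1 [of "1 - \<beta>"] by (simp add: field_simps)
  finally show ?thesis
  proof (rule Lim_transform_eventually)
    show "\<forall>\<^sub>F t in at_top. (F 0 t * inverse t + F 1 t) / (F 1 t * inverse t + F 2 t) =
        t * deriv (caputo_sol \<beta> r) t / caputo_sol \<beta> r t"
      using eventually_gt_at_top [of 0]
    proof eventually_elim
      case (elim t)
      have "x t > 0" using elim assms by (simp add: x_def mult_neg_pos)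
      define E where "E b = mittag_leffler2 \<beta> b (- x t)" for b
      have d: "deriv (caputo_sol \<beta> r) t = E 0 / t + E 1"
        using deriv_caputo_sol [of \<beta> r t] assms elim by (simp add: E_def x_def)
      have s: "caputo_sol \<beta> r t = E 1 + t * E 2"
        by (simp add: caputo_sol_def mittag_leffler_conv_mittag_leffler2 E_def x_def)
      have "F 0 t * inverse t + F 1 t = x t / t * (E 0 + t * E 1)"
        "F 1 t * inverse t + F 2 t = x t / t * (E 1 + t * E 2)"
        using elim by (auto simp: F_def E_def field_simps)
      moreover have "x t / t \<noteq> 0" using elim \<open>x t > 0\<close> by simp
      ultimately have "(F 0 t * inverse t + F 1 t) / (F 1 t * inverse t + F 2 t) =
          (E 0 + t * E 1) / (E 1 + t * E 2)"
        by (metis mult_divide_mult_cancel_left)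
      thus ?case using elim by (simp add: d s distrib_left)
    qed
  qed
qed

end
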